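(* Suppose that $(\mathbb{H}^n,\theta_0,f)$ is a CR Yamabe soliton, i.e. $f$ is a real-valued smooth function on the Heisenberg group $\mathbb{H}^n$ which together with a constant $\mu$ satisfies the CR Yamabe soliton equations for the standard contact form $\theta_0$. Then the potential function $f$ must be of the form $$f(z,t)=2\mu t+\sum_{p_i,q_i=0,1}C_{p_1q_1\cdots p_nq_n}z_1^{p_1}\overline{z}_1^{q_1}z_2^{p_2}\overline{z}_2^{q_2}\cdots z_n^{p_n}\overline{z}_n^{q_n},$$ where the sum is over all $p_1,q_1,\dots,p_n,q_n\in\{0,1\}$ and $C_{p_1q_1\cdots p_nq_n}$ are constants such that $f$ is a real-valued function.
   Context: CR Yamabe soliton: a strictly pseudoconvex CR manifold $(M,\theta)$ of real dimension $2n+1$ is a CR Yamabe soliton with potential function $f$, written $(M,\theta,f)$, if $f$ is a real-valued smooth function and there is a constant $\mu$ with $$R_\theta+\tfrac12 f_0=\mu,\qquad f_{\alpha\alpha}+\sqrt{-1}A_{\alpha\alpha}f=0\ \text{ for all }\alpha=1,\dots,n.$$ Here $R_\theta$ is the Tanaka-Webster scalar curvature, $A_{\alpha\beta}$ the pseudohermitian torsion, $f_0=Tf$ where $T$ is the characteristic vector field ($\theta(T)=1$, $d\theta(T,\cdot)=0$), and $f_{\alpha\beta}=Z_\beta Z_\alpha f-\omega_\alpha^\gamma(Z_\beta)Z_\gamma f$, where $\{Z_\alpha\}$ is the frame of $T_{1,0}$ and $\omega_\alpha^\gamma$ are the Tanaka-Webster connection 1-forms ($DZ_\alpha=\omega_\alpha^\gamma\otimes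 Z_\gamma$). Heisenberg group: $\mathbb{H}^n=\mathbb{C}^n\times\mathbb{R}$ with coordinates $(z,t)=(z_1,\dots,z_n,t)$, standard contact form $\theta_0=dt+\sqrt{-1}\sum_{i=1}^n(z_i\,d\overline z_i-\overline z_i\,dz_i)$, and frame $$Z_\alpha=\frac{1}{\sqrt2}\left(\frac{\partial}{\partial z_\alpha}+\sqrt{-1}\,\overline z_\alpha\frac{\partial}{\partial t}\right),\quad 1\le\alpha\le n,$$ of $T_{1,0}$; $T=\partial/\partial t$. The Tanaka-Webster scalar curvature and the torsion of $(\mathbb{H}^n,\theta_0)$ vanish (and the connection forms vanish in this frame), so the soliton equations read $\frac12 f_0=\mu$ and $f_{\alpha\alpha}=Z_\alpha Z_\alpha f=0$ for all $\alpha=1,\dots,n$. *)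

theory Defs
  imports "HOL-Analysis.Analysis"
begin

text \<open>Manifolds are modelled here by a Euclidean space \<open>'a\<close> in global coordinates; the tangent
  space at every point is \<open>'a\<close> itself. That covers the Heisenberg group.\<close>

section \<open>Smooth functions, complex tangent vectors, differential forms\<close>

primrec times_cont_diff ::
    "nat \<Rightarrow> ('a::real_normed_vector \<Rightarrow> 'b::real_normed_vector) \<Rightarrow> bool" where
  "times_cont_diff 0 f \<longleftrightarrow> continuous_on UNIV f"
| "times_cont_diff (Suc k) f \<longleftrightarrow> (\<forall>x. f differentiable (at x)) \<and>
     (\<forall>v. times_cont_diff k (\<lambda>x. frechet_derivative f (at x) v))"

definition smooth :: "('a::real_normed_vector \<Rightarrow> 'b::real_normed_vector) \<Rightarrow> bool" where
  "smooth f \<longleftrightarrow> (\<forall>k. times_cont_diff k f)"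

text \<open>The pair \<open>(u, v)\<close> stands for the complexified tangent vector \<open>u + \<i> v\<close>.\<close>

type_synonym 'a ctangent = "'a \<times> 'a"

definition cnj_vec :: "'a::real_vector ctangent \<Rightarrow> 'a ctangent" where
  "cnj_vec w = (fst w, - snd w)"

definition cscale :: "complex \<Rightarrow> 'a::real_vector ctangent \<Rightarrow> 'a ctangent" where
  "cscale c w = (Re c *\<^sub>R fst w - Im c *\<^sub>R snd w, Im c *\<^sub>R fst w + Re c *\<^sub>R snd w)"

text \<open>Complex (bi)linear extension of real (bi)linear maps to complexified tangent vectors.\<close>

definition cext :: "('a \<Rightarrow> complex) \<Rightarrow> 'a ctangent \<Rightarrow> complex" where
  "cext L w = L (fst w) + \<i> * L (snd w)"

definition cext2 :: "('a \<Rightarrow> 'a \<Rightarrow> complex) \<Rightarrow> 'a ctangent \<Rightarrow> 'a ctangent \<Rightarrow> complex" where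
  "cext2 B w w' = cext (\<lambda>u. cext (B u) w') w"

text \<open>A complex-valued \<open>1\<close>-form is \<open>\<phi> x u\<close> with base point \<open>x\<close> and real tangent vector \<open>u\<close>.
  Conventions for \<open>2\<close>-forms: \<open>(\<phi> \<and> \<psi>)(u, v) = \<phi>(u) \<psi>(v) - \<phi>(v) \<psi>(u)\<close> and
  \<open>d\<phi>(X, Y) = X \<phi>(Y) - Y \<phi>(X) - \<phi>([X, Y])\<close>, without factors \<open>1/2\<close>.\<close>

type_synonym 'a cform = "'a \<Rightarrow> 'a \<Rightarrow> complex"

definition one_form :: "'a::euclidean_space cform \<Rightarrow> bool" where
  "one_form \<phi> \<longleftrightarrow> (\<forall>x. linear (\<phi> x)) \<and> (\<forall>u. smooth (\<lambda>x. \<phi> x u))"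

definition ext_deriv :: "'a::euclidean_space cform \<Rightarrow> 'a \<Rightarrow> 'a \<Rightarrow> 'a \<Rightarrow> complex" where
  "ext_deriv \<phi> x u v =
     frechet_derivative (\<lambda>y. \<phi> y v) (at x) u - frechet_derivative (\<lambda>y. \<phi> y u) (at x) v"

definition wedge :: "'a cform \<Rightarrow> 'a cform \<Rightarrow> 'a \<Rightarrow> 'a \<Rightarrow> 'a \<Rightarrow> complex" where
  "wedge \<phi> \<psi> x u v = \<phi> x u * \<psi> x v - \<phi> x v * \<psi> x u"

definition cnj_form :: "'a cform \<Rightarrow> 'a cform" where
  "cnj_form \<phi> x u = cnj (\<phi> x u)"

definition along ::
    "('a \<Rightarrow> 'a ctangent) \<Rightarrow> ('a::euclidean_space \<Rightarrow> complex) \<Rightarrow> 'a \<Rightarrow> complex" where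
  "along W g x = cext (frechet_derivative g (at x)) (W x)"

section \<open>Pseudohermitian structures and the Tanaka-Webster connection\<close>

text \<open>\<open>Z\<close> is a global frame of \<open>T\<^sub>1\<^sub>,\<^sub>0\<close> and \<open>T\<close> the characteristic vector field.\<close>

definition levi ::
    "'a::euclidean_space cform \<Rightarrow> ('n::finite \<Rightarrow> 'a \<Rightarrow> 'a ctangent) \<Rightarrow> 'a \<Rightarrow> complex^'n^'n" where
  "levi \<theta> Z x = (\<chi> \<alpha> \<beta>. - \<i> * cext2 (ext_deriv \<theta> x) (Z \<alpha> x) (cnj_vec (Z \<beta> x)))"

definition strictly_pseudoconvex ::
    "'a::euclidean_space cform \<Rightarrow> ('a \<Rightarrow> 'a) \<Rightarrow> ('n::finite \<Rightarrow> 'a \<Rightarrow> 'a ctangent) \<Rightarrow> bool" where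
  "strictly_pseudoconvex \<theta> T Z \<longleftrightarrow>
     DIM('a) = 2 * CARD('n) + 1 \<and>
     one_form \<theta> \<and> (\<forall>x u. \<theta> x u \<in> \<real>) \<and> smooth T \<and> (\<forall>\<alpha>. smooth (Z \<alpha>)) \<and>
     (\<forall>x. \<theta> x (T x) = 1 \<and> (\<forall>u. ext_deriv \<theta> x (T x) u = 0)) \<and>
     (\<forall>x \<alpha>. cext (\<theta> x) (Z \<alpha> x) = 0) \<and>
     (\<forall>x c. c \<noteq> 0 \<longrightarrow>
        0 < Re (\<Sum>\<alpha>\<in>UNIV. \<Sum>\<beta>\<in>UNIV. levi \<theta> Z x $ \<alpha> $ \<beta> * c $ \<alpha> * cnj (c $ \<beta>)))"

text \<open>The admissible coframe \<open>\<theta>\<^sup>\<alpha>\<close> dual to the frame, with \<open>\<theta>\<^sup>\<alpha>(T) = 0\<close>.\<close>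

definition admissible_coframe ::
    "('a \<Rightarrow> 'a) \<Rightarrow> ('n::finite \<Rightarrow> 'a \<Rightarrow> 'a::euclidean_space ctangent) \<Rightarrow> ('n \<Rightarrow> 'a cform) \<Rightarrow> bool" where
  "admissible_coframe T Z \<Theta> \<longleftrightarrow> (\<forall>\<alpha>. one_form (\<Theta> \<alpha>)) \<and>
     (\<forall>\<alpha> \<beta> x. cext (\<Theta> \<alpha> x) (Z \<beta> x) = (if \<alpha> = \<beta> then 1 else 0) \<and>
        cext (\<Theta> \<alpha> x) (cnj_vec (Z \<beta> x)) = 0 \<and> \<Theta> \<alpha> x (T x) = 0)"

text \<open>Webster's structure equations, which determine the connection forms
  \<open>\<omega> \<alpha> \<beta> = \<omega>\<^sub>\<alpha>\<^sup>\<beta>\<close> and the torsion \<open>A \<alpha> \<beta> = A\<^sub>\<alpha>\<^sub>\<beta>\<close>. With \<open>h\<close> the Levi matrix and bars denoting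
  conjugation, they read in order
    \<open>d\<theta> = \<i> h\<^sub>\<alpha>\<^sub>\<beta> \<theta>\<^sup>\<alpha> \<and> bar(\<theta>\<^sup>\<beta>)\<close>,
    \<open>d\<theta>\<^sup>\<beta> = \<theta>\<^sup>\<alpha> \<and> \<omega>\<^sub>\<alpha>\<^sup>\<beta> + \<theta> \<and> \<tau>\<^sup>\<beta>\<close>,
    \<open>h\<^sub>\<alpha>\<^sub>\<beta> bar(\<tau>\<^sup>\<beta>) = A\<^sub>\<alpha>\<^sub>\<beta> \<theta>\<^sup>\<beta>\<close>,
    \<open>dh\<^sub>\<alpha>\<^sub>\<beta> = \<omega>\<^sub>\<alpha>\<^sup>\<gamma> h\<^sub>\<gamma>\<^sub>\<beta> + h\<^sub>\<alpha>\<^sub>\<gamma> bar(\<omega>\<^sub>\<beta>\<^sup>\<gamma>)\<close>;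
  the second index of \<open>h\<close> is the conjugate one. The second and third together also contain
  the integrability of \<open>T\<^sub>1\<^sub>,\<^sub>0\<close>. Testing on real tangent vectors suffices.\<close>

definition tanaka_webster ::
    "'a::euclidean_space cform \<Rightarrow> ('a \<Rightarrow> 'a) \<Rightarrow> ('n::finite \<Rightarrow> 'a \<Rightarrow> 'a ctangent) \<Rightarrow>
     ('n \<Rightarrow> 'n \<Rightarrow> 'a cform) \<Rightarrow> ('n \<Rightarrow> 'n \<Rightarrow> 'a \<Rightarrow> complex) \<Rightarrow> bool" where
  "tanaka_webster \<theta> T Z \<omega> A \<longleftrightarrow>
     (\<forall>\<alpha> \<beta>. one_form (\<omega> \<alpha> \<beta>)) \<and>
     (\<exists>\<Theta> \<tau>. admissible_coframe T Z \<Theta> \<and> (\<forall>\<beta>. one_form (\<tau> \<beta>)) \<and>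
       (\<forall>x u v. ext_deriv \<theta> x u v =
          \<i> * (\<Sum>\<alpha>\<in>UNIV. \<Sum>\<beta>\<in>UNIV. levi \<theta> Z x $ \<alpha> $ \<beta> * wedge (\<Theta> \<alpha>) (cnj_form (\<Theta> \<beta>)) x u v)) \<and>
       (\<forall>\<beta> x u v. ext_deriv (\<Theta> \<beta>) x u v =
          (\<Sum>\<alpha>\<in>UNIV. wedge (\<Theta> \<alpha>) (\<omega> \<alpha> \<beta>) x u v) + wedge \<theta> (\<tau> \<beta>) x u v) \<and>
       (\<forall>\<alpha> x u. (\<Sum>\<beta>\<in>UNIV. levi \<theta> Z x $ \<alpha> $ \<beta> * cnj (\<tau> \<beta> x u)) =
          (\<Sum>\<beta>\<in>UNIV. A \<alpha> \<beta> x * \<Theta> \<beta> x u)) \<and>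
       (\<forall>\<alpha> \<beta> x u. frechet_derivative (\<lambda>y. levi \<theta> Z y $ \<alpha> $ \<beta>) (at x) u =
          (\<Sum>\<gamma>\<in>UNIV. \<omega> \<alpha> \<gamma> x u * levi \<theta> Z x $ \<gamma> $ \<beta> + levi \<theta> Z x $ \<alpha> $ \<gamma> * cnj (\<omega> \<beta> \<gamma> x u))))"

text \<open>Curvature \<open>\<Pi>\<^sub>\<beta>\<^sup>\<alpha> = d\<omega>\<^sub>\<beta>\<^sup>\<alpha> - \<omega>\<^sub>\<beta>\<^sup>\<gamma> \<and> \<omega>\<^sub>\<gamma>\<^sup>\<alpha>\<close>. The Ricci tensor \<open>R\<^sub>\<rho>\<^sub>\<sigma>\<close> (\<open>\<sigma>\<close> conjugate) is the
  \<open>\<theta>\<^sup>\<rho> \<and> bar(\<theta>\<^sup>\<sigma>)\<close> coefficient of \<open>\<Pi>\<^sub>\<gamma>\<^sup>\<gamma>\<close>, and the scalar curvature is its trace with respect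
  to \<open>h\<close>. The torsion terms in Webster's formula for \<open>\<Pi>\<close> have no such component.\<close>

definition curv_form ::
    "('n::finite \<Rightarrow> 'n \<Rightarrow> 'a::euclidean_space cform) \<Rightarrow> 'n \<Rightarrow> 'n \<Rightarrow> 'a \<Rightarrow> 'a \<Rightarrow> 'a \<Rightarrow> complex" where
  "curv_form \<omega> \<beta> \<alpha> x u v =
     ext_deriv (\<omega> \<beta> \<alpha>) x u v - (\<Sum>\<gamma>\<in>UNIV. wedge (\<omega> \<beta> \<gamma>) (\<omega> \<gamma> \<alpha>) x u v)"

definition tw_ricci ::
    "('n::finite \<Rightarrow> 'a::euclidean_space \<Rightarrow> 'a ctangent) \<Rightarrow> ('n \<Rightarrow> 'n \<Rightarrow> 'a cform) \<Rightarrow> 'a \<Rightarrow>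
     complex^'n^'n" where
  "tw_ricci Z \<omega> x = (\<chi> \<rho> \<sigma>.
     cext2 (\<lambda>u v. \<Sum>\<gamma>\<in>UNIV. curv_form \<omega> \<gamma> \<gamma> x u v) (Z \<rho> x) (cnj_vec (Z \<sigma> x)))"

definition tw_scalar ::
    "'a::euclidean_space cform \<Rightarrow> ('n::finite \<Rightarrow> 'a \<Rightarrow> 'a ctangent) \<Rightarrow> ('n \<Rightarrow> 'n \<Rightarrow> 'a cform) \<Rightarrow>
     'a \<Rightarrow> complex" where
  "tw_scalar \<theta> Z \<omega> x = trace (matrix_inv (levi \<theta> Z x) ** tw_ricci Z \<omega> x)"

text \<open>\<open>f\<^sub>\<alpha>\<^sub>\<beta> = Z\<^sub>\<beta> Z\<^sub>\<alpha> f - \<omega>\<^sub>\<alpha>\<^sup>\<gamma>(Z\<^sub>\<beta>) Z\<^sub>\<gamma> f\<close>\<close>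

definition cov_hess ::
    "('n::finite \<Rightarrow> 'a::euclidean_space \<Rightarrow> 'a ctangent) \<Rightarrow> ('n \<Rightarrow> 'n \<Rightarrow> 'a cform) \<Rightarrow>
     ('a \<Rightarrow> real) \<Rightarrow> 'n \<Rightarrow> 'n \<Rightarrow> 'a \<Rightarrow> complex" where
  "cov_hess Z \<omega> f \<alpha> \<beta> x =
     along (Z \<beta>) (along (Z \<alpha>) (\<lambda>y. complex_of_real (f y))) x
     - (\<Sum>\<gamma>\<in>UNIV. cext (\<omega> \<alpha> \<gamma> x) (Z \<beta> x) * along (Z \<gamma>) (\<lambda>y. complex_of_real (f y)) x)"

text \<open>The soliton equations are imposed in the given frame \<open>Z\<close>; \<open>\<mu>\<close> is the constant.\<close>

definition CR_Yamabe_soliton ::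
    "'a::euclidean_space cform \<Rightarrow> ('a \<Rightarrow> 'a) \<Rightarrow> ('n::finite \<Rightarrow> 'a \<Rightarrow> 'a ctangent) \<Rightarrow>
     ('a \<Rightarrow> real) \<Rightarrow> real \<Rightarrow> bool" where
  "CR_Yamabe_soliton \<theta> T Z f \<mu> \<longleftrightarrow>
     strictly_pseudoconvex \<theta> T Z \<and> smooth f \<and>
     (\<exists>\<omega> A. tanaka_webster \<theta> T Z \<omega> A \<and>
       (\<forall>x. tw_scalar \<theta> Z \<omega> x + of_real (1/2 * frechet_derivative f (at x) (T x)) = of_real \<mu>) \<and>
       (\<forall>\<alpha> x. cov_hess Z \<omega> f \<alpha> \<alpha> x + \<i> * A \<alpha> \<alpha> x * of_real (f x) = 0))"

section \<open>The Heisenberg group\<close>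

type_synonym 'n heisenberg = "(complex^'n) \<times> real"

text \<open>\<open>\<theta>\<^sub>0 = dt + \<i> \<Sum> (z\<^sub>i d bar(z\<^sub>i) - bar(z\<^sub>i) dz\<^sub>i)\<close>\<close>

definition heis_theta :: "'n::finite heisenberg cform" where
  "heis_theta x u = of_real (snd u)
     + \<i> * (\<Sum>i\<in>UNIV. fst x $ i * cnj (fst u $ i) - cnj (fst x $ i) * fst u $ i)"

definition heis_T :: "'n::finite heisenberg \<Rightarrow> 'n heisenberg" where
  "heis_T x = (0, 1)"

text \<open>\<open>\<partial>/\<partial>z\<^sub>\<alpha> = 1/2 (\<partial>/\<partial>x\<^sub>\<alpha> - \<i> \<partial>/\<partial>y\<^sub>\<alpha>)\<close>\<close>

definition heis_dz :: "'n::finite \<Rightarrow> 'n heisenberg ctangent" where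
  "heis_dz \<alpha> = (1/2) *\<^sub>R ((axis \<alpha> 1, 0), - (axis \<alpha> \<i>, 0))"

definition heis_Z :: "'n::finite \<Rightarrow> 'n heisenberg \<Rightarrow> 'n heisenberg ctangent" where
  "heis_Z \<alpha> x = (1 / sqrt 2) *\<^sub>R
     (heis_dz \<alpha> + cscale (\<i> * cnj (fst x $ \<alpha>)) (heis_T x, 0))"

end

theory Submission
  imports Defs
begin

text \<open>Why the theorem is true. The Heisenberg frame is so rigid that Webster's structure
  equations have only the trivial solution: the coframe dual to \<open>Z\<^sub>\<alpha>\<close> is \<open>\<theta>\<^sup>\<alpha> = sqrt 2 dz\<^sub>\<alpha>\<close>, which is
  closed, and the Levi matrix is the identity. Testing
  \<open>0 = \<theta>\<^sup>\<alpha> \<and> \<omega>\<^sub>\<alpha>\<^sup>\<beta> + \<theta> \<and> \<tau>\<^sup>\<beta>\<close> on pairs of frame vectors kills the torsion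
  (\<open>heis_torsion_zero\<close>) and all components of \<open>\<omega>\<close> except those along \<open>Z\<^sub>\<gamma>\<close>, and these vanish because
  \<open>\<omega>\<close> is skew-hermitian (\<open>heis_connection_zero\<close>). So the soliton equations are \<open>T f = 2 \<mu>\<close> and
  \<open>Z\<^sub>\<alpha> Z\<^sub>\<alpha> f = 0\<close> (\<open>heis_soliton_equations\<close>).

  The first equation says \<open>f(z, t) = f(z, 0) + 2 \<mu> t\<close>. Given it, the second one is
  \<open>\<partial>\<^sup>2f / \<partial>z\<^sub>\<alpha>\<^sup>2 = 0\<close>, since the two contributions of \<open>T\<close> cancel (\<open>heis_Z_Z_real\<close>). As \<open>f\<close> is real, this
  complex equation splits into \<open>f\<^sub>x\<^sub>x = f\<^sub>y\<^sub>y\<close> and \<open>f\<^sub>x\<^sub>y = 0\<close> with \<open>z\<^sub>\<alpha> = x + \<i> y\<close>. Differentiating once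
  more, \<open>f\<^sub>x\<^sub>x\<^sub>x = f\<^sub>y\<^sub>y\<^sub>x = 0\<close> and likewise \<open>f\<^sub>y\<^sub>y\<^sub>y = 0\<close>, so in each complex coordinate separately \<open>f\<close> is
  \<open>k + p x + q y + m (x\<^sup>2 + y\<^sup>2) / 2\<close>, a combination of \<open>1\<close>, \<open>w\<close>, \<open>cnj w\<close> and \<open>w cnj w\<close>
  (\<open>plane_quadratic\<close>, \<open>heis_soliton_biaffine\<close>).

  It remains to pass from each variable separately to all of them jointly. The four coefficients in one
  variable are fixed linear combinations of values of the function, hence have the same property in
  the remaining variables, and induction over the set of coordinates gives the polynomial
  (\<open>separately_biaffine_squarefree_poly\<close>).\<close>

section \<open>Directional derivatives of smooth functions\<close>

definition dir_deriv :: "'a::real_normed_vector \<Rightarrow> ('a \<Rightarrow> real) \<Rightarrow> 'a \<Rightarrow> real" where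
  "dir_deriv u f x = frechet_derivative f (at x) u"

lemma smooth_differentiable: "smooth f \<Longrightarrow> f differentiable (at x)"
  unfolding smooth_def using times_cont_diff.simps(2) by blast

lemma smooth_isCont: "smooth f \<Longrightarrow> isCont f x"
  by (simp add: differentiable_imp_continuous_within smooth_differentiable)

lemma smooth_dir_deriv: "smooth f \<Longrightarrow> smooth (dir_deriv u f)"
  unfolding smooth_def dir_deriv_def using times_cont_diff.simps(2) by blast

lemma smooth_has_derivative:
  "smooth f \<Longrightarrow> (f has_derivative (\<lambda>u. dir_deriv u f x)) (at x)"
  by (simp add: dir_deriv_def frechet_derivative_works[symmetric] smooth_differentiable)

lemma dir_deriv_unique: "(f has_derivative D) (at x) \<Longrightarrow> dir_deriv u f x = D u"
  unfolding dir_deriv_def using frechet_derivative_at by metis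

lemma smooth_DERIV_line:
  assumes "smooth f"
  shows "((\<lambda>s. f (x + s *\<^sub>R u)) has_real_derivative dir_deriv u f (x + s *\<^sub>R u)) (at s)"
proof -
  let ?y = "x + s *\<^sub>R u"
  have lin: "linear (\<lambda>v. dir_deriv v f ?y)"
    using smooth_has_derivative[OF assms] by (rule has_derivative_linear)
  have "((\<lambda>s. x + s *\<^sub>R u) has_derivative (\<lambda>h. h *\<^sub>R u)) (at s)"
    by (auto intro!: derivative_eq_intros)
  from has_derivative_compose[OF this smooth_has_derivative[OF assms]]
  have "((\<lambda>s. f (x + s *\<^sub>R u)) has_derivative (\<lambda>h. dir_deriv (h *\<^sub>R u) f ?y)) (at s)" .
  moreover have "(\<lambda>h. dir_deriv (h *\<^sub>R u) f ?y) = (\<lambda>h. dir_deriv u f ?y * h)"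
    using linear_cmul[OF lin] by (auto simp: mult.commute)
  ultimately show ?thesis
    by (simp add: has_field_derivative_def)
qed

text \<open>The second difference over a small parallelogram is symmetric in \<open>u\<close> and \<open>v\<close>, while the mean value
  theorem, applied first along \<open>u\<close> and then along \<open>v\<close>, turns it into one of the two mixed derivatives.\<close>

lemma second_difference_mean_value:
  assumes "smooth f" and "h > 0"
  obtains \<xi> \<eta> where "0 < \<xi>" "\<xi> < h" "0 < \<eta>" "\<eta> < h"
    "f (x + h *\<^sub>R u + h *\<^sub>R v) - f (x + h *\<^sub>R u) - f (x + h *\<^sub>R v) + f x =
     h * h * dir_deriv v (dir_deriv u f) (x + \<xi> *\<^sub>R u + \<eta> *\<^sub>R v)"
proof -
  have swap: "x + s *\<^sub>R u + h *\<^sub>R v = x + h *\<^sub>R v + s *\<^sub>R u" for s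
    by simp
  have "((\<lambda>s. f (x + h *\<^sub>R v + s *\<^sub>R u) - f (x + s *\<^sub>R u)) has_real_derivative
      dir_deriv u f (x + h *\<^sub>R v + s *\<^sub>R u) - dir_deriv u f (x + s *\<^sub>R u)) (at s)" for s
    by (intro DERIV_diff smooth_DERIV_line assms)
  from MVT2[OF assms(2) this] obtain \<xi> where \<xi>: "0 < \<xi>" "\<xi> < h"
    and 1: "f (x + h *\<^sub>R v + h *\<^sub>R u) - f (x + h *\<^sub>R u) - (f (x + h *\<^sub>R v) - f x) =
      h * (dir_deriv u f (x + h *\<^sub>R v + \<xi> *\<^sub>R u) - dir_deriv u f (x + \<xi> *\<^sub>R u))"
    by auto
  have "((\<lambda>r. dir_deriv u f (x + \<xi> *\<^sub>R u + r *\<^sub>R v)) has_real_derivative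
      dir_deriv v (dir_deriv u f) (x + \<xi> *\<^sub>R u + r *\<^sub>R v)) (at r)" for r
    by (intro smooth_DERIV_line smooth_dir_deriv assms)
  from MVT2[OF assms(2) this] obtain \<eta> where \<eta>: "0 < \<eta>" "\<eta> < h"
    and 2: "dir_deriv u f (x + \<xi> *\<^sub>R u + h *\<^sub>R v) - dir_deriv u f (x + \<xi> *\<^sub>R u) =
      h * dir_deriv v (dir_deriv u f) (x + \<xi> *\<^sub>R u + \<eta> *\<^sub>R v)"
    by auto
  show thesis
    using that[OF \<xi> \<eta>] 1 2 by (simp add: swap algebra_simps)
qed

text \<open>Both mixed derivatives equal the same second difference quotient at points near \<open>x\<close>; by continuity
  they agree at \<open>x\<close>.\<close>

lemma dir_deriv_commute:
  assumes "smooth f"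
  shows "dir_deriv u (dir_deriv v f) = dir_deriv v (dir_deriv u f)"
proof
  fix x
  let ?P = "dir_deriv v (dir_deriv u f)" and ?Q = "dir_deriv u (dir_deriv v f)"
  have "\<bar>?P x - ?Q x\<bar> < 2 * e" if "e > 0" for e
  proof -
    have "isCont ?P x" "isCont ?Q x"
      by (intro smooth_isCont smooth_dir_deriv assms)+
    then have "\<exists>d1>0. \<forall>y. dist y x < d1 \<longrightarrow> \<bar>?P y - ?P x\<bar> < e"
      and "\<exists>d2>0. \<forall>y. dist y x < d2 \<longrightarrow> \<bar>?Q y - ?Q x\<bar> < e"
      using that unfolding continuous_at_eps_delta dist_real_def by blast+
    then obtain d1 d2 where d: "d1 > 0" "d2 > 0"
      and d1: "\<And>y. dist y x < d1 \<Longrightarrow> \<bar>?P y - ?P x\<bar> < e"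
      and d2: "\<And>y. dist y x < d2 \<Longrightarrow> \<bar>?Q y - ?Q x\<bar> < e"
      by blast
    \<comment> \<open>Parallelograms of side \<open>h\<close> stay in the smaller of the two balls; the \<open>1\<close> keeps \<open>K\<close> positive
      when \<open>u = v = 0\<close>.\<close>
    define K where "K = norm u + norm v + 1"
    have K: "K > 0" "norm u + norm v < K"
      unfolding K_def by (auto intro: add_nonneg_pos)
    define h where "h = min d1 d2 / K"
    have h: "h > 0" "h * K = min d1 d2"
      using d K by (auto simp: h_def)
    have near: "dist (x + a *\<^sub>R u + b *\<^sub>R v) x < min d1 d2"
      if "0 < a" "a < h" "0 < b" "b < h" for a b
    proof -
      have "dist (x + a *\<^sub>R u + b *\<^sub>R v) x = norm (a *\<^sub>R u + b *\<^sub>R v)"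
        by (simp add: dist_norm add.assoc)
      also have "\<dots> \<le> a * norm u + b * norm v"
        using norm_triangle_ineq[of "a *\<^sub>R u" "b *\<^sub>R v"] that by simp
      also have "\<dots> \<le> h * norm u + h * norm v"
        using that by (intro add_mono mult_right_mono) auto
      also have "\<dots> < h * K"
        using mult_strict_left_mono[OF K(2) h(1)] by (simp only: distrib_left)
      finally show ?thesis
        by (simp only: h(2))
    qed
    obtain a b where ab: "0 < a" "a < h" "0 < b" "b < h"
      and eq1: "f (x + h *\<^sub>R u + h *\<^sub>R v) - f (x + h *\<^sub>R u) - f (x + h *\<^sub>R v) + f x =
        h * h * ?P (x + a *\<^sub>R u + b *\<^sub>R v)"
      using second_difference_mean_value[OF assms h(1)] by blast
    obtain a' b' where ab': "0 < a'" "a' < h" "0 < b'" "b' < h"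
      and eq2: "f (x + h *\<^sub>R v + h *\<^sub>R u) - f (x + h *\<^sub>R v) - f (x + h *\<^sub>R u) + f x =
        h * h * ?Q (x + a' *\<^sub>R v + b' *\<^sub>R u)"
      using second_difference_mean_value[OF assms h(1)] by blast
    have swap: "x + h *\<^sub>R v + h *\<^sub>R u = x + h *\<^sub>R u + h *\<^sub>R v"
      by simp
    have "h * h * ?P (x + a *\<^sub>R u + b *\<^sub>R v) = h * h * ?Q (x + a' *\<^sub>R v + b' *\<^sub>R u)"
      using eq1 eq2[unfolded swap] by linarith
    then have "?P (x + a *\<^sub>R u + b *\<^sub>R v) = ?Q (x + b' *\<^sub>R u + a' *\<^sub>R v)"
      using h(1) by (simp add: add.commute add.left_commute)
    moreover have "\<bar>?P (x + a *\<^sub>R u + b *\<^sub>R v) - ?P x\<bar> < e"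
      using d1 near ab by simp
    moreover have "\<bar>?Q (x + b' *\<^sub>R u + a' *\<^sub>R v) - ?Q x\<bar> < e"
      using d2 near ab' by simp
    ultimately show ?thesis
      by linarith
  qed
  from this[of "\<bar>?P x - ?Q x\<bar> / 2"] have "\<not> ?P x \<noteq> ?Q x"
    by auto
  then show "?Q x = ?P x"
    by simp
qed

lemma constant_dir_deriv_line:
  assumes "smooth f" and "\<And>y. dir_deriv u f y = c"
  shows "f (x + s *\<^sub>R u) = f x + s * c"
proof -
  have "((\<lambda>s. f (x + s *\<^sub>R u) - s * c) has_real_derivative c - c) (at s)" for s
    using smooth_DERIV_line[OF assms(1), of x u s] assms(2)
    by (auto intro!: derivative_eq_intros)
  then have "f (x + s *\<^sub>R u) - s * c = f (x + 0 *\<^sub>R u) - 0 * c"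
    by (intro DERIV_isconst_all) auto
  then show ?thesis by simp
qed

lemma third_dir_deriv_zero_line:
  assumes "smooth f" and "\<And>y. dir_deriv u (dir_deriv u (dir_deriv u f)) y = 0"
  shows "f (x + s *\<^sub>R u) = f x + s * dir_deriv u f x + s\<^sup>2 / 2 * dir_deriv u (dir_deriv u f) x"
proof -
  let ?g = "dir_deriv u f" and ?c = "dir_deriv u (dir_deriv u f) x"
  have h: "dir_deriv u (dir_deriv u f) (x + s *\<^sub>R u) = ?c" for s
    using constant_dir_deriv_line[OF _ assms(2)] assms(1) by (simp add: smooth_dir_deriv)
  have "((\<lambda>s. ?g (x + s *\<^sub>R u) - s * ?c) has_real_derivative ?c - ?c) (at s)" for s
    using smooth_DERIV_line[OF smooth_dir_deriv[OF assms(1)], of u x u s] h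
    by (auto intro!: derivative_eq_intros)
  then have "?g (x + s *\<^sub>R u) - s * ?c = ?g (x + 0 *\<^sub>R u) - 0 * ?c" for s
    by (intro DERIV_isconst_all) auto
  then have g: "?g (x + s *\<^sub>R u) = ?g x + s * ?c" for s
    by (simp add: algebra_simps)
  have "((\<lambda>s. f (x + s *\<^sub>R u) - (s * ?g x + s\<^sup>2 / 2 * ?c)) has_real_derivative 0) (at s)" for s
    using smooth_DERIV_line[OF assms(1), of x u s] g
    by (auto intro!: derivative_eq_intros)
  then have "f (x + s *\<^sub>R u) - (s * ?g x + s\<^sup>2 / 2 * ?c) = f (x + 0 *\<^sub>R u) - (0 * ?g x + 0\<^sup>2 / 2 * ?c)"
    by (intro DERIV_isconst_all) auto
  then show ?thesis by simp
qed

text \<open>A Hessian that is everywhere a multiple of the identity in the plane of \<open>u\<close> and \<open>v\<close> must be a constant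
  multiple: its third derivatives vanish, because \<open>uuu f = u(vv f) = v(uv f) = 0\<close>, and symmetrically
  \<open>vvv f = 0\<close>.\<close>

lemma plane_quadratic:
  fixes f :: "'a::real_normed_vector \<Rightarrow> real"
  assumes f: "smooth f"
    and mixed: "\<And>y. dir_deriv u (dir_deriv v f) y = 0"
    and equal: "\<And>y. dir_deriv u (dir_deriv u f) y = dir_deriv v (dir_deriv v f) y"
  shows "f (x + s *\<^sub>R u + r *\<^sub>R v) = f x + s * dir_deriv u f x + r * dir_deriv v f x +
    (s\<^sup>2 + r\<^sup>2) / 2 * dir_deriv u (dir_deriv u f) x"
proof -
  note [simp] = smooth_dir_deriv[OF f] smooth_dir_deriv[OF smooth_dir_deriv[OF f]]
  have mixed': "dir_deriv u (dir_deriv v f) = (\<lambda>_. 0)" "dir_deriv v (dir_deriv u f) = (\<lambda>_. 0)"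
    and equal': "dir_deriv u (dir_deriv u f) = dir_deriv v (dir_deriv v f)"
    using mixed equal dir_deriv_commute[OF f, of u v] by auto
  have zero: "dir_deriv w (\<lambda>_. 0) y = 0" for w y :: 'a
    by (rule dir_deriv_unique[OF has_derivative_const])
  have uuu: "dir_deriv u (dir_deriv u (dir_deriv u f)) y = 0" for y
    unfolding equal' dir_deriv_commute[of "dir_deriv v f" u v, simplified] mixed' by (rule zero)
  have vvv: "dir_deriv v (dir_deriv v (dir_deriv v f)) y = 0" for y
    unfolding equal'[symmetric] dir_deriv_commute[of "dir_deriv u f" v u, simplified] mixed' by (rule zero)
  have "dir_deriv v f (x + s *\<^sub>R u) = dir_deriv v f x"
    using constant_dir_deriv_line[of "dir_deriv v f" u 0] mixed by simp
  moreover have "dir_deriv v (dir_deriv v f) (x + s *\<^sub>R u) = dir_deriv v (dir_deriv v f) x"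
    using constant_dir_deriv_line[of "dir_deriv v (dir_deriv v f)" u 0] uuu by (simp add: equal'[symmetric])
  ultimately show ?thesis
    using third_dir_deriv_zero_line[OF f vvv, of "x + s *\<^sub>R u" r] third_dir_deriv_zero_line[OF f uuu, of x s]
    by (simp add: equal' field_simps)
qed

section \<open>The Tanaka-Webster connection of the Heisenberg group\<close>

text \<open>Webster's equations are imposed on real tangent vectors. The following rules carry them over to
  the complex frame vectors.\<close>

lemma cext_cnj:
  assumes "linear L"
  shows "cext (\<lambda>u. cnj (L u)) w = cnj (cext L (cnj_vec w))"
  using linear_neg[OF assms] by (simp add: cext_def cnj_vec_def)

lemma cext2_wedge:
  "cext2 (wedge \<phi> \<psi> x) w w' = cext (\<phi> x) w * cext (\<psi> x) w' - cext (\<phi> x) w' * cext (\<psi> x) w"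
  by (simp add: cext2_def cext_def wedge_def algebra_simps)

lemma cext2_add: "cext2 (\<lambda>u v. B u v + B' u v) w w' = cext2 B w w' + cext2 B' w w'"
  by (simp add: cext2_def cext_def algebra_simps)

lemma cext2_sum: "cext2 (\<lambda>u v. \<Sum>i\<in>I. B i u v) w w' = (\<Sum>i\<in>I. cext2 (B i) w w')"
  by (simp add: cext2_def cext_def distrib_left sum.distrib sum_negf sum_subtractf sum_distrib_left)

lemma heis_Z_eq:
  "heis_Z \<alpha> x =
    ((1 / sqrt 2) *\<^sub>R ((1 / 2) *\<^sub>R axis \<alpha> 1, Im (fst x $ \<alpha>)),
     (1 / sqrt 2) *\<^sub>R ((1 / 2) *\<^sub>R axis \<alpha> (- \<i>), Re (fst x $ \<alpha>)))"
  by (simp add: heis_Z_def heis_dz_def heis_T_def cscale_def vec_eq_iff axis_def)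

lemma cnj_heis_Z_eq:
  "cnj_vec (heis_Z \<alpha> x) =
    ((1 / sqrt 2) *\<^sub>R ((1 / 2) *\<^sub>R axis \<alpha> 1, Im (fst x $ \<alpha>)),
     (1 / sqrt 2) *\<^sub>R ((1 / 2) *\<^sub>R axis \<alpha> \<i>, - Re (fst x $ \<alpha>)))"
  by (simp add: heis_Z_eq cnj_vec_def vec_eq_iff axis_def)

lemma heis_axis_component:
  "fst (r *\<^sub>R (k *\<^sub>R axis \<beta> a, s :: real)) $ i = (if i = \<beta> then of_real (r * k) * a else (0 :: complex))"
  by (simp add: axis_def, simp add: scaleR_conv_of_real)

lemma complex_vec_expansion:
  fixes z :: "complex^'n::finite"
  shows "z = (\<Sum>i\<in>UNIV. Re (z $ i) *\<^sub>R axis i 1 + Im (z $ i) *\<^sub>R axis i \<i>)"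
proof -
  have "Re (z $ i) *\<^sub>R axis i (1::complex) + Im (z $ i) *\<^sub>R axis i \<i> = axis i (z $ i)" for i
    by (auto simp: vec_eq_iff axis_def complex_eq_iff)
  moreover have "(\<Sum>i\<in>UNIV. axis i (z $ i)) = z"
    by (simp add: vec_eq_iff axis_def)
  ultimately show ?thesis by simp
qed

text \<open>The vectors \<open>Z\<^sub>\<alpha>\<close>, their conjugates and \<open>T\<close> span the complexified tangent space: the real and
  imaginary parts of \<open>Z\<^sub>\<alpha>\<close> are, up to a multiple of \<open>T\<close>, nonzero multiples of the coordinate vectors
  of \<open>z\<^sub>\<alpha>\<close>. So a linear form is determined by its values on the frame.\<close>

lemma heis_linear_zeroI:
  fixes L :: "'n::finite heisenberg \<Rightarrow> complex"
  assumes L: "linear L"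
    and Z: "\<And>\<alpha>. cext L (heis_Z \<alpha> x) = 0"
    and Zbar: "\<And>\<alpha>. cext L (cnj_vec (heis_Z \<alpha> x)) = 0"
    and T: "L (heis_T x) = 0"
  shows "L u = 0"
proof -
  have T0: "L (0, t) = 0" for t
    using T linear_scale[OF L, of t "(0, 1)"] by (simp add: heis_T_def)
  have split: "L (v, t) = L (v, 0)" for v t
    using linear_add[OF L, of "(v, 0)" "(0, t)"] T0 by simp
  have "L (fst (heis_Z \<alpha> x)) = 0" "L (snd (heis_Z \<alpha> x)) = 0" for \<alpha>
    using Z[of \<alpha>] Zbar[of \<alpha>] linear_neg[OF L] by (simp_all add: cext_def cnj_vec_def)
  then have "L ((1 / 2) *\<^sub>R axis \<alpha> 1, Im (fst x $ \<alpha>)) = 0"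
    "L ((1 / 2) *\<^sub>R axis \<alpha> (- \<i>), Re (fst x $ \<alpha>)) = 0" for \<alpha>
    by (simp_all only: heis_Z_eq fst_conv snd_conv linear_scale[OF L] scaleR_eq_0_iff) simp_all
  then have half: "L ((1 / 2) *\<^sub>R axis \<alpha> 1, 0) = 0" "L ((1 / 2) *\<^sub>R axis \<alpha> (- \<i>), 0) = 0" for \<alpha>
    by (metis split)+
  have axis_neg: "- axis \<alpha> (- \<i>) = axis \<alpha> \<i>" for \<alpha> :: 'n
    by (simp add: vec_eq_iff axis_def)
  have axis: "L (axis \<alpha> 1, 0) = 0" "L (axis \<alpha> \<i>, 0) = 0" for \<alpha>
    using linear_scale[OF L, of 2 "((1 / 2) *\<^sub>R axis \<alpha> 1, 0)"] half(1)[of \<alpha>]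
      linear_scale[OF L, of "- 2" "((1 / 2) *\<^sub>R axis \<alpha> (- \<i>), 0)"] half(2)[of \<alpha>]
      axis_neg
    by simp_all
  obtain v t where u: "u = (v, t)"
    by (cases u)
  have lin: "linear (\<lambda>v. L (v, 0))"
    using linear_compose[OF _ L, of "\<lambda>v. (v, 0)"]
    by (simp add: linear_iff o_def)
  have "L (v, 0) = L (\<Sum>i\<in>UNIV. Re (v $ i) *\<^sub>R axis i 1 + Im (v $ i) *\<^sub>R axis i \<i>, 0)"
    using complex_vec_expansion[of v] by simp
  also have "\<dots> = (\<Sum>i\<in>UNIV. Re (v $ i) *\<^sub>R L (axis i 1, 0) + Im (v $ i) *\<^sub>R L (axis i \<i>, 0))"
    unfolding linear_sum[OF lin] linear_add[OF lin] linear_scale[OF lin] ..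
  finally have "L (v, 0) = \<dots>" .
  then show ?thesis
    using axis by (simp add: u split[of v t])
qed

lemma heis_theta_axis:
  "heis_theta x (r *\<^sub>R (k *\<^sub>R axis \<beta> a, s)) =
    of_real r * (of_real s + \<i> * of_real k * (fst x $ \<beta> * cnj a - cnj (fst x $ \<beta>) * a))"
proof -
  have sum_eq: "(\<Sum>i\<in>UNIV. fst x $ i * cnj (fst (r *\<^sub>R (k *\<^sub>R axis \<beta> a, s)) $ i) -
      cnj (fst x $ i) * fst (r *\<^sub>R (k *\<^sub>R axis \<beta> a, s)) $ i) =
    (\<Sum>i\<in>UNIV. if i = \<beta> then of_real (r * k) * (fst x $ \<beta> * cnj a - cnj (fst x $ \<beta>) * a) else 0)"
    unfolding heis_axis_component by (intro sum.cong refl) (simp add: algebra_simps)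
  show ?thesis
    unfolding heis_theta_def sum_eq by (simp add: algebra_simps)
qed

lemma cext_heis_theta_Zbar: "cext (heis_theta x) (cnj_vec (heis_Z \<alpha> x)) = 0"
  unfolding cnj_heis_Z_eq
  by (simp add: cext_def heis_theta_axis complex_eq_iff del: scaleR_Pair)

text \<open>This is \<open>d\<theta>\<^sub>0 = 2 \<i> \<Sum>\<^sub>i dz\<^sub>i \<and> d bar(z\<^sub>i)\<close>. The frame has constant \<open>z\<close>-components, so the Levi matrix
  computed from it below does not depend on the point.\<close>

lemma ext_deriv_heis_theta:
  fixes x u v :: "'n::finite heisenberg"
  shows
  "ext_deriv heis_theta x u v =
    2 * \<i> * (\<Sum>i\<in>UNIV. fst u $ i * cnj (fst v $ i) - cnj (fst u $ i) * fst v $ i)"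
proof -
  have D: "frechet_derivative (\<lambda>y. heis_theta y v) (at x) u =
      \<i> * (\<Sum>i\<in>UNIV. fst u $ i * cnj (fst v $ i) - cnj (fst u $ i) * fst v $ i)"
    for u v :: "'n heisenberg"
  proof -
    have coord: "((\<lambda>y :: 'n heisenberg. fst y $ i) has_derivative (\<lambda>u. fst u $ i)) (at x)" for i
      by (intro bounded_linear_imp_has_derivative bounded_linear_compose[OF bounded_linear_vec_nth bounded_linear_fst])
    have "((\<lambda>y. heis_theta y v) has_derivative
        (\<lambda>u. 0 + \<i> * (\<Sum>i\<in>UNIV. fst u $ i * cnj (fst v $ i) - cnj (fst u $ i) * fst v $ i))) (at x)"
      unfolding heis_theta_def
      by (intro has_derivative_add has_derivative_const has_derivative_mult_right has_derivative_sum
        has_derivative_diff has_derivative_mult_left has_derivative_cnj coord)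
    then show ?thesis
      by (simp flip: frechet_derivative_at)
  qed
  have "ext_deriv heis_theta x u v =
    \<i> * ((\<Sum>i\<in>UNIV. fst u $ i * cnj (fst v $ i) - cnj (fst u $ i) * fst v $ i) -
      (\<Sum>i\<in>UNIV. fst v $ i * cnj (fst u $ i) - cnj (fst v $ i) * fst u $ i))"
    unfolding ext_deriv_def D by (simp only: right_diff_distrib)
  also have "\<dots> = \<i> * (\<Sum>i\<in>UNIV. 2 * (fst u $ i * cnj (fst v $ i) - cnj (fst u $ i) * fst v $ i))"
    unfolding sum_subtractf[symmetric] by (simp add: algebra_simps)
  also have "\<dots> = 2 * \<i> * (\<Sum>i\<in>UNIV. fst u $ i * cnj (fst v $ i) - cnj (fst u $ i) * fst v $ i)"
    by (simp only: sum_distrib_left[symmetric] mult.assoc mult.left_commute[of \<i> 2])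
  finally show ?thesis .
qed

lemma levi_heis:
  fixes x :: "'n::finite heisenberg"
  shows "levi heis_theta heis_Z x = mat 1"
proof -
  have E: "ext_deriv heis_theta x (r *\<^sub>R (k *\<^sub>R axis \<alpha> a, s)) (r *\<^sub>R (l *\<^sub>R axis \<beta> b, t)) =
      (if \<alpha> = \<beta> then 2 * \<i> * of_real (r * r * k * l) * (a * cnj b - cnj a * b) else 0)"
    for r k l s t :: real and \<alpha> \<beta> :: 'n and a b
  proof -
    have "(\<Sum>i\<in>UNIV. fst (r *\<^sub>R (k *\<^sub>R axis \<alpha> a, s)) $ i * cnj (fst (r *\<^sub>R (l *\<^sub>R axis \<beta> b, t)) $ i) -
        cnj (fst (r *\<^sub>R (k *\<^sub>R axis \<alpha> a, s)) $ i) * fst (r *\<^sub>R (l *\<^sub>R axis \<beta> b, t)) $ i) =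
      (\<Sum>i\<in>UNIV. if i = \<alpha>
        then if \<alpha> = \<beta> then of_real (r * r * k * l) * (a * cnj b - cnj a * b) else 0 else 0)"
      unfolding heis_axis_component by (intro sum.cong refl) (simp add: algebra_simps)
    then show ?thesis
      unfolding ext_deriv_heis_theta by simp
  qed
  have "levi heis_theta heis_Z x $ \<alpha> $ \<beta> = (if \<alpha> = \<beta> then 1 else 0)" for \<alpha> \<beta> :: 'n
  proof -
    show ?thesis
      unfolding levi_def cnj_heis_Z_eq unfolding heis_Z_eq
      by (simp add: cext2_def cext_def E del: scaleR_Pair)
  qed
  then show ?thesis
    by (simp add: vec_eq_iff mat_def)
qed

text \<open>The form \<open>sqrt 2 dz\<^sub>\<alpha>\<close> takes the prescribed values on the frame, and there is no other such form.
  What matters later is that it has constant coefficients and is therefore closed.\<close>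

lemma heis_coframe_eq:
  fixes \<Theta> :: "'n::finite \<Rightarrow> 'n heisenberg cform"
  assumes "admissible_coframe heis_T heis_Z \<Theta>"
  shows "\<Theta> \<alpha> x u = of_real (sqrt 2) * fst u $ \<alpha>"
proof -
  have lin: "linear (\<Theta> \<alpha> x)"
    using assms unfolding admissible_coframe_def one_form_def by blast
  let ?L = "\<lambda>u :: 'n heisenberg. \<Theta> \<alpha> x u - of_real (sqrt 2) * fst u $ \<alpha>"
  have "?L u = 0"
  proof (rule heis_linear_zeroI[of ?L x])
    show "linear ?L"
      by (intro linear_compose_sub lin) (simp add: linear_iff distrib_left)
    have *: "cext (\<Theta> \<alpha> x) (heis_Z \<beta> x) = (if \<alpha> = \<beta> then 1 else 0)"
      "cext (\<Theta> \<alpha> x) (cnj_vec (heis_Z \<beta> x)) = 0" "\<Theta> \<alpha> x (heis_T x) = 0" for \<beta>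
      using assms unfolding admissible_coframe_def by blast+
    have diff: "cext ?L w = cext (\<Theta> \<alpha> x) w - of_real (sqrt 2) * cext (\<lambda>u. fst u $ \<alpha>) w" for w
      by (simp add: cext_def algebra_simps)
    have dz: "cext (\<lambda>u. fst u $ \<alpha>) (heis_Z \<beta> x) = (if \<alpha> = \<beta> then 1 / of_real (sqrt 2) else 0)"
      "cext (\<lambda>u. fst u $ \<alpha>) (cnj_vec (heis_Z \<beta> x)) = 0" for \<beta>
      unfolding cnj_heis_Z_eq unfolding heis_Z_eq cext_def fst_conv snd_conv heis_axis_component
      by simp_all
    show "cext ?L (heis_Z \<beta> x) = 0" "cext ?L (cnj_vec (heis_Z \<beta> x)) = 0" for \<beta>
      unfolding diff * dz by simp_all
    show "?L (heis_T x) = 0"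
      using * by (simp add: heis_T_def)
  qed
  then show ?thesis by simp
qed

text \<open>With a closed coframe and constant Levi matrix, the structure equations become linear and homogeneous in
  \<open>\<omega>\<close> and \<open>\<tau>\<close>. The pair \<open>(T, bar(Z)\<^sub>\<beta>)\<close> isolates \<open>A\<^sub>\<alpha>\<^sub>\<beta>\<close>, since \<open>\<tau>\<^sup>\<alpha>\<close> is a combination of the
  conjugate forms; then the pairs \<open>(Z\<^sub>\<alpha>, w)\<close> with \<open>w\<close> annihilated by the coframe show \<open>\<omega>(w) = 0\<close>;
  conjugation and skew-hermitian symmetry supply the values on \<open>Z\<^sub>\<gamma>\<close>.\<close>

lemma
  fixes \<omega> :: "'n::finite \<Rightarrow> 'n \<Rightarrow> 'n heisenberg cform"
  assumes tw: "tanaka_webster heis_theta heis_T heis_Z \<omega> A"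
  shows heis_torsion_zero: "A \<alpha> \<beta> x = 0"
    and heis_connection_zero: "\<omega> \<alpha> \<beta> x u = 0"
proof -
  from tw obtain \<Theta> \<tau> where \<omega>: "\<And>\<alpha> \<beta>. one_form (\<omega> \<alpha> \<beta>)"
    and \<Theta>: "admissible_coframe heis_T heis_Z \<Theta>" and \<tau>: "\<And>\<beta>. one_form (\<tau> \<beta>)"
    and eq2: "\<And>\<beta> x u v. ext_deriv (\<Theta> \<beta>) x u v =
          (\<Sum>\<alpha>\<in>UNIV. wedge (\<Theta> \<alpha>) (\<omega> \<alpha> \<beta>) x u v) + wedge heis_theta (\<tau> \<beta>) x u v"
    and eq3: "\<And>\<alpha> x u. (\<Sum>\<beta>\<in>UNIV. levi heis_theta heis_Z x $ \<alpha> $ \<beta> * cnj (\<tau> \<beta> x u)) =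
          (\<Sum>\<beta>\<in>UNIV. A \<alpha> \<beta> x * \<Theta> \<beta> x u)"
    and eq4: "\<And>\<alpha> \<beta> x u. frechet_derivative (\<lambda>y. levi heis_theta heis_Z y $ \<alpha> $ \<beta>) (at x) u =
          (\<Sum>\<gamma>\<in>UNIV. \<omega> \<alpha> \<gamma> x u * levi heis_theta heis_Z x $ \<gamma> $ \<beta> +
            levi heis_theta heis_Z x $ \<alpha> $ \<gamma> * cnj (\<omega> \<beta> \<gamma> x u))"
    unfolding tanaka_webster_def by blast
  have lin: "linear (\<omega> \<alpha> \<beta> x)" "linear (\<tau> \<beta> x)" "linear (\<Theta> \<beta> x)" for \<alpha> \<beta> x
    using \<omega> \<tau> \<Theta> unfolding one_form_def admissible_coframe_def by blast+
  have \<Theta>Z: "cext (\<Theta> \<alpha> x) (heis_Z \<beta> x) = (if \<alpha> = \<beta> then 1 else 0)"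
    and \<Theta>Zbar: "cext (\<Theta> \<alpha> x) (cnj_vec (heis_Z \<beta> x)) = 0"
    and "\<Theta> \<alpha> x (heis_T x) = 0" for \<alpha> \<beta> x
    using \<Theta> unfolding admissible_coframe_def by blast+
  then have \<Theta>T: "cext (\<Theta> \<alpha> x) (heis_T x, 0) = 0" for \<alpha> x
    using linear_0[OF lin(3)] by (simp add: cext_def)
  have thetaT: "cext (heis_theta x) (heis_T x, 0) = 1" for x :: "'n heisenberg"
    by (simp add: cext_def heis_theta_def heis_T_def)
  have thetaZbar: "cext (heis_theta x) (cnj_vec (heis_Z \<beta> x)) = 0" for x :: "'n heisenberg" and \<beta>
    by (rule cext_heis_theta_Zbar)
  have "ext_deriv (\<Theta> \<beta>) x u v = 0" for \<beta> x u v
    by (simp add: ext_deriv_def heis_coframe_eq[OF \<Theta>])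
  then have "(\<lambda>u v. (\<Sum>\<alpha>\<in>UNIV. wedge (\<Theta> \<alpha>) (\<omega> \<alpha> \<beta>) x u v) + wedge heis_theta (\<tau> \<beta>) x u v) =
      (\<lambda>u v. 0)" for \<beta> x
    using eq2 by simp
  from arg_cong[OF this, of cext2]
  have "cext2 (\<lambda>u v. (\<Sum>\<alpha>\<in>UNIV. wedge (\<Theta> \<alpha>) (\<omega> \<alpha> \<beta>) x u v) + wedge heis_theta (\<tau> \<beta>) x u v) w w' =
      cext2 (\<lambda>u v. 0) w w'" for \<beta> x w w'
    by (rule fun_cong[OF fun_cong])
  then have structure_eq: "(\<Sum>\<alpha>\<in>UNIV. cext (\<Theta> \<alpha> x) w * cext (\<omega> \<alpha> \<beta> x) w' - cext (\<Theta> \<alpha> x) w' * cext (\<omega> \<alpha> \<beta> x) w) +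
      (cext (heis_theta x) w * cext (\<tau> \<beta> x) w' - cext (heis_theta x) w' * cext (\<tau> \<beta> x) w) = 0"
    for \<beta> x w w'
    unfolding cext2_add cext2_sum cext2_wedge by (simp add: cext2_def[of "\<lambda>u v. 0"] cext_def[of "\<lambda>u. 0"])
  have torsion: "cnj (\<tau> \<alpha> x u) = (\<Sum>\<beta>\<in>UNIV. A \<alpha> \<beta> x * \<Theta> \<beta> x u)" for \<alpha> x u
    using eq3[of x \<alpha> u] by (simp add: levi_heis mat_def if_distrib[of "\<lambda>a. a * _"] cong: if_cong)
  have "cnj (cext (\<tau> \<alpha> x) (cnj_vec (heis_Z \<beta> x))) = A \<alpha> \<beta> x" for \<alpha> \<beta> x
  proof -
    have "cnj (cext (\<tau> \<alpha> x) (cnj_vec (heis_Z \<beta> x))) = (\<Sum>\<gamma>\<in>UNIV. A \<alpha> \<gamma> x * cext (\<Theta> \<gamma> x) (heis_Z \<beta> x))"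
      unfolding cext_cnj[OF lin(2), symmetric] torsion
      by (simp add: cext_def sum.distrib sum_distrib_left algebra_simps)
    then show ?thesis
      by (simp add: \<Theta>Z if_distrib[of "\<lambda>a. _ * a"] cong: if_cong)
  qed
  moreover have "cext (\<tau> \<alpha> x) (cnj_vec (heis_Z \<beta> x)) = 0" for \<alpha> \<beta> x
    using structure_eq[of x "(heis_T x, 0)" \<alpha> "cnj_vec (heis_Z \<beta> x)"]
    by (simp add: \<Theta>T \<Theta>Zbar thetaT thetaZbar)
  ultimately have A: "A \<alpha> \<beta> x = 0" for \<alpha> \<beta> x
    by (metis complex_cnj_zero)
  then show "A \<alpha> \<beta> x = 0" .
  from A torsion have \<tau>0: "\<tau> \<alpha> x u = 0" for \<alpha> x u
    by simp
  \<comment> \<open>Pairing with \<open>Z\<^sub>\<alpha>\<close> picks out one summand \<open>\<omega>\<^sub>\<alpha>\<^sup>\<beta>(w)\<close>; this covers \<open>w = T\<close> and \<open>w = bar(Z)\<^sub>\<gamma>\<close>.\<close>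
  have select: "cext (\<omega> \<alpha> \<beta> x) w = 0"
    if "\<And>\<gamma>. cext (\<Theta> \<gamma> x) w = 0" for \<alpha> \<beta> x w
    using structure_eq[of x "heis_Z \<alpha> x" \<beta> w] that
    by (simp add: \<Theta>Z \<tau>0 cext_def[of "\<tau> _ _"] if_distrib[of "\<lambda>a. a * _"] cong: if_cong)
  \<comment> \<open>Metric compatibility for the constant Levi matrix \<open>1\<close>.\<close>
  have skew: "\<omega> \<alpha> \<beta> x u + cnj (\<omega> \<beta> \<alpha> x u) = 0" for \<alpha> \<beta> x u
    using eq4[of \<alpha> \<beta> x u]
    by (simp add: levi_heis mat_def sum.distrib if_distrib[of "\<lambda>a. a * _"]
      if_distrib[of "\<lambda>a. _ * a"] cong: if_cong)
  show "\<omega> \<alpha> \<beta> x u = 0"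
  proof (rule heis_linear_zeroI[of "\<omega> \<alpha> \<beta> x" x])
    show "linear (\<omega> \<alpha> \<beta> x)"
      by (rule lin)
    show "cext (\<omega> \<alpha> \<beta> x) (cnj_vec (heis_Z \<gamma> x)) = 0" for \<gamma>
      by (intro select \<Theta>Zbar)
    have "cext (\<omega> \<alpha> \<beta> x) (heis_Z \<gamma> x) = - cnj (cext (\<omega> \<beta> \<alpha> x) (cnj_vec (heis_Z \<gamma> x)))" for \<gamma>
      using skew[of \<alpha> \<beta> x] unfolding cext_cnj[OF lin(1), symmetric]
      by (simp add: cext_def eq_neg_iff_add_eq_0 algebra_simps flip: distrib_left)
    then show "cext (\<omega> \<alpha> \<beta> x) (heis_Z \<gamma> x) = 0" for \<gamma>
      using select[OF \<Theta>Zbar] by simp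
    show "\<omega> \<alpha> \<beta> x (heis_T x) = 0"
      using select[OF \<Theta>T] linear_0[OF lin(1)] by (simp add: cext_def)
  qed
qed

section \<open>The soliton equations in coordinates\<close>

abbreviation heis_X :: "'n::finite \<Rightarrow> 'n heisenberg" where "heis_X \<alpha> \<equiv> (axis \<alpha> 1, 0)"
abbreviation heis_Y :: "'n::finite \<Rightarrow> 'n heisenberg" where "heis_Y \<alpha> \<equiv> (axis \<alpha> \<i>, 0)"

lemma along_has_derivative:
  "(F has_derivative F') (at x) \<Longrightarrow> along W F x = cext F' (W x)"
  unfolding along_def by (simp flip: frechet_derivative_at)

lemma cext_heis_Z:
  fixes L :: "'n::finite heisenberg \<Rightarrow> complex"
  assumes L: "linear L"
  shows "cext L (heis_Z \<alpha> x) = of_real (1 / sqrt 2) *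
    (1 / 2 * (L (heis_X \<alpha>) - \<i> * L (heis_Y \<alpha>)) + \<i> * cnj (fst x $ \<alpha>) * L (0, 1))"
proof -
  have "fst (heis_Z \<alpha> x) = (1 / sqrt 2) *\<^sub>R ((1 / 2) *\<^sub>R heis_X \<alpha> + Im (fst x $ \<alpha>) *\<^sub>R (0, 1))"
    and "snd (heis_Z \<alpha> x) = (1 / sqrt 2) *\<^sub>R (- (1 / 2) *\<^sub>R heis_Y \<alpha> + Re (fst x $ \<alpha>) *\<^sub>R (0, 1))"
    by (simp_all add: heis_Z_eq vec_eq_iff axis_def)
  moreover have "\<i> * cnj (fst x $ \<alpha>) = of_real (Im (fst x $ \<alpha>)) + \<i> * of_real (Re (fst x $ \<alpha>))"
    by (simp add: complex_eq_iff)
  ultimately show ?thesis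
    unfolding cext_def
    by (simp only: linear_add[OF L] linear_scale[OF L]) (simp add: scaleR_conv_of_real algebra_simps)
qed

lemma has_derivative_of_real_smooth:
  fixes f :: "'a::real_normed_vector \<Rightarrow> real"
  assumes "smooth f"
  shows "((\<lambda>y. complex_of_real (f y)) has_derivative (\<lambda>u. of_real (dir_deriv u f x))) (at x)"
  by (intro has_derivative_of_real smooth_has_derivative assms)

lemma heis_Z_real:
  fixes f :: "'n::finite heisenberg \<Rightarrow> real"
  assumes "smooth f"
  shows "along (heis_Z \<alpha>) (\<lambda>y. of_real (f y)) x = of_real (1 / sqrt 2) *
    (1 / 2 * (of_real (dir_deriv (heis_X \<alpha>) f x) - \<i> * of_real (dir_deriv (heis_Y \<alpha>) f x)) +
     \<i> * cnj (fst x $ \<alpha>) * of_real (dir_deriv (0, 1) f x))"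
  unfolding along_has_derivative[OF has_derivative_of_real_smooth[OF assms]]
  by (rule cext_heis_Z[OF has_derivative_linear[OF has_derivative_of_real_smooth[OF assms]]])

text \<open>When \<open>T f\<close> is a constant \<open>c\<close>, it contributes to \<open>Z\<^sub>\<alpha> f\<close> only a multiple of \<open>bar(z\<^sub>\<alpha>)\<close>, which \<open>Z\<^sub>\<alpha>\<close>
  annihilates. What is left is the second Wirtinger derivative of \<open>f\<close>, with the factor \<open>1/2\<close> from the
  normalisation of the frame.\<close>

lemma heis_Z_Z_real:
  fixes f :: "'n::finite heisenberg \<Rightarrow> real"
  assumes f: "smooth f" and T: "\<And>y. dir_deriv (0, 1) f y = c"
  shows "along (heis_Z \<alpha>) (along (heis_Z \<alpha>) (\<lambda>y. of_real (f y))) x = 1 / 8 *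
    (of_real (dir_deriv (heis_X \<alpha>) (dir_deriv (heis_X \<alpha>) f) x - dir_deriv (heis_Y \<alpha>) (dir_deriv (heis_Y \<alpha>) f) x)
     - 2 * \<i> * of_real (dir_deriv (heis_X \<alpha>) (dir_deriv (heis_Y \<alpha>) f) x))"
proof -
  let ?P = "dir_deriv (heis_X \<alpha>) f" and ?Q = "dir_deriv (heis_Y \<alpha>) f"
  let ?r = "complex_of_real (1 / sqrt 2)"
  define L where "L u = ?r * (1 / 2 * (of_real (dir_deriv u ?P x) - \<i> * of_real (dir_deriv u ?Q x)) +
      \<i> * cnj (fst u $ \<alpha>) * of_real c)" for u
  have "((\<lambda>y :: 'n heisenberg. fst y $ \<alpha>) has_derivative (\<lambda>u. fst u $ \<alpha>)) (at x)"
    by (intro bounded_linear_imp_has_derivative bounded_linear_compose[OF bounded_linear_vec_nth bounded_linear_fst])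
  then have "((\<lambda>y. ?r * (1 / 2 * (of_real (?P y) - \<i> * of_real (?Q y)) + \<i> * cnj (fst y $ \<alpha>) * of_real c))
      has_derivative L) (at x)"
    unfolding L_def
    by (intro has_derivative_mult_right has_derivative_mult_left has_derivative_add has_derivative_diff
      has_derivative_cnj has_derivative_of_real_smooth smooth_dir_deriv f)
  then have der: "(along (heis_Z \<alpha>) (\<lambda>y. of_real (f y)) has_derivative L) (at x)"
    by (simp only: heis_Z_real[OF f, abs_def] T)
  \<comment> \<open>First derivatives of \<open>f\<close> do not depend on \<open>t\<close>, so the \<open>T\<close>-part of the second \<open>Z\<^sub>\<alpha>\<close> drops out.\<close>
  have T0: "dir_deriv (0, 1) (dir_deriv u f) x = 0" for u
  proof -
    have "dir_deriv (0, 1) f = (\<lambda>_. c)"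
      using T by blast
    then show ?thesis
      unfolding dir_deriv_commute[OF f, of "(0, 1)"] by (simp add: dir_deriv_unique[OF has_derivative_const])
  qed
  have rr: "?r * (?r * w) = w / 2" for w
    by (simp flip: of_real_mult mult.assoc)
  have "cext L (heis_Z \<alpha> x) = ?r * (1 / 2 * (L (heis_X \<alpha>) - \<i> * L (heis_Y \<alpha>)))"
    unfolding cext_heis_Z[OF has_derivative_linear[OF der]] by (simp add: L_def T0)
  also have "L (heis_X \<alpha>) - \<i> * L (heis_Y \<alpha>) = ?r * (1 / 2 *
      (of_real (dir_deriv (heis_X \<alpha>) ?P x - dir_deriv (heis_Y \<alpha>) ?Q x) -
       \<i> * (of_real (dir_deriv (heis_X \<alpha>) ?Q x) + of_real (dir_deriv (heis_Y \<alpha>) ?P x))))"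
    by (simp add: L_def axis_def algebra_simps)
  also have "dir_deriv (heis_Y \<alpha>) ?P x = dir_deriv (heis_X \<alpha>) ?Q x"
    by (simp add: dir_deriv_commute[OF f, of "heis_Y \<alpha>"])
  finally show ?thesis
    unfolding along_has_derivative[OF der] mult.left_commute[of "1 / 2" ?r] rr
    by (simp add: algebra_simps)
qed

text \<open>The connection and torsion in the definition of a soliton are only given implicitly, by the structure
  equations. As they must vanish, so do the scalar curvature and all correction terms.\<close>

lemma heis_soliton_equations:
  fixes f :: "'n::finite heisenberg \<Rightarrow> real"
  assumes "CR_Yamabe_soliton heis_theta heis_T (heis_Z :: 'n \<Rightarrow> _) f \<mu>"
  shows "smooth f" and "dir_deriv (0, 1) f x = 2 * \<mu>"
    and "along (heis_Z \<alpha>) (along (heis_Z \<alpha>) (\<lambda>y. of_real (f y))) x = 0"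
proof -
  from assms obtain \<omega> A where f: "smooth f"
    and tw: "tanaka_webster heis_theta heis_T (heis_Z :: 'n \<Rightarrow> _) \<omega> A"
    and scalar: "\<And>x. tw_scalar heis_theta heis_Z \<omega> x +
      of_real (1 / 2 * frechet_derivative f (at x) (heis_T x)) = of_real \<mu>"
    and hess: "\<And>\<alpha> x. cov_hess heis_Z \<omega> f \<alpha> \<alpha> x + \<i> * A \<alpha> \<alpha> x * of_real (f x) = 0"
    unfolding CR_Yamabe_soliton_def by blast
  have \<omega>: "\<omega> = (\<lambda>_ _ _ _. 0)"
    by (intro ext heis_connection_zero[OF tw])
  have "ext_deriv (\<lambda>_ _. 0) x u v = 0" for x u v :: "'n heisenberg"
    by (simp add: ext_deriv_def)
  then have "tw_ricci heis_Z \<omega> x = 0" for x :: "'n heisenberg"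
    by (simp add: \<omega> tw_ricci_def curv_form_def wedge_def cext2_def cext_def vec_eq_iff)
  then have "tw_scalar heis_theta heis_Z \<omega> x = 0" for x :: "'n heisenberg"
    by (simp add: tw_scalar_def trace_def matrix_matrix_mult_def)
  then have "complex_of_real (1 / 2 * dir_deriv (0, 1) f x) = of_real \<mu>"
    using scalar[of x] by (simp add: dir_deriv_def heis_T_def)
  then show "dir_deriv (0, 1) f x = 2 * \<mu>"
    unfolding of_real_eq_iff by simp
  show "along (heis_Z \<alpha>) (along (heis_Z \<alpha>) (\<lambda>y. of_real (f y))) x = 0"
    using hess[of \<alpha> x] by (simp add: cov_hess_def \<omega> heis_torsion_zero[OF tw] cext_def)
  show "smooth f"
    by (rule f)
qed

section \<open>Functions that are biaffine in each complex coordinate\<close>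

definition upd_coord :: "'a^'n \<Rightarrow> 'n::finite \<Rightarrow> 'a \<Rightarrow> 'a^'n" where
  "upd_coord z i w = (\<chi> j. if j = i then w else z $ j)"

lemma upd_coord_nth [simp]: "upd_coord z i w $ j = (if j = i then w else z $ j)"
  by (simp add: upd_coord_def)

lemma upd_coord_idem [simp]: "upd_coord (upd_coord z i v) i w = upd_coord z i w"
  by (simp add: vec_eq_iff)

lemma upd_coord_same [simp]: "upd_coord z i (z $ i) = z"
  by (simp add: vec_eq_iff)

lemma upd_coord_commute:
  "i \<noteq> j \<Longrightarrow> upd_coord (upd_coord z i v) j w = upd_coord (upd_coord z j w) i v"
  by (simp add: vec_eq_iff)

text \<open>Affine in \<open>w\<close> and in \<open>cnj w\<close>, treated as independent variables.\<close>

definition biaffine :: "(complex \<Rightarrow> complex) \<Rightarrow> bool" where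
  "biaffine h \<longleftrightarrow> (\<exists>a b c d. \<forall>w. h w = a + b * w + c * cnj w + d * (w * cnj w))"

lemma biaffine_add:
  assumes "biaffine g" and "biaffine h"
  shows "biaffine (\<lambda>w. g w + h w)"
proof -
  obtain a b c d a' b' c' d' where
    "\<And>w. g w = a + b * w + c * cnj w + d * (w * cnj w)"
    "\<And>w. h w = a' + b' * w + c' * cnj w + d' * (w * cnj w)"
    using assms unfolding biaffine_def by blast
  then have "g w + h w = (a + a') + (b + b') * w + (c + c') * cnj w + (d + d') * (w * cnj w)" for w
    by (simp add: algebra_simps)
  then show ?thesis unfolding biaffine_def by blast
qed

lemma biaffine_cmult:
  assumes "biaffine h"
  shows "biaffine (\<lambda>w. k * h w)"
proof -
  obtain a b c d where "\<And>w. h w = a + b * w + c * cnj w + d * (w * cnj w)"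
    using assms unfolding biaffine_def by blast
  then have "k * h w = k * a + (k * b) * w + (k * c) * cnj w + (k * d) * (w * cnj w)" for w
    by (simp add: algebra_simps)
  then show ?thesis unfolding biaffine_def by blast
qed

text \<open>The coefficient of \<open>w\<^sup>p (cnj w)\<^sup>q\<close> in a biaffine function \<open>h\<close>, recovered by interpolation at \<open>0\<close>, \<open>1\<close>,
  \<open>-1\<close> and \<open>\<i>\<close>. A formula by values of \<open>h\<close>, rather than a choice of coefficients, makes it linear
  in \<open>h\<close>; this is what lets properties in other variables pass to the coefficients.\<close>

definition biaffine_coeff :: "nat \<Rightarrow> nat \<Rightarrow> (complex \<Rightarrow> complex) \<Rightarrow> complex" where
  "biaffine_coeff p q h =
     (if p = 0 \<and> q = 0 then h 0
      else if p = 1 \<and> q = 1 then (h 1 + h (- 1)) / 2 - h 0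
      else (h 1 - h (- 1) + (if p = 1 then \<i> else - \<i>) * (h 1 + h (- 1) - 2 * h \<i>)) / 4)"

lemma biaffine_expansion:
  assumes "biaffine h"
  shows "h w = (\<Sum>p\<in>{0,1}. \<Sum>q\<in>{0,1}. biaffine_coeff p q h * (w ^ p * cnj w ^ q))"
proof -
  obtain a b c d where h: "\<And>w. h w = a + b * w + c * cnj w + d * (w * cnj w)"
    using assms unfolding biaffine_def by blast
  have ii: "\<i> * (\<i> * x) = - x" for x
    by (simp flip: mult.assoc)
  have "biaffine_coeff 0 0 h = a" "biaffine_coeff 1 1 h = d"
    by (simp_all add: biaffine_coeff_def h add_divide_distrib)
  moreover have "biaffine_coeff 1 0 h = b" "biaffine_coeff 0 1 h = c"
    by (simp_all add: biaffine_coeff_def h algebra_simps ii)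
  ultimately show ?thesis
    by (simp add: h)
qed

lemma biaffine_biaffine_coeff:
  assumes "\<And>v. biaffine (\<lambda>w. F w v)"
  shows "biaffine (\<lambda>w. biaffine_coeff p q (F w))"
proof -
  \<comment> \<open>Every coefficient is a linear combination of the values at the four nodes.\<close>
  have lin: "biaffine (\<lambda>w. k0 * F w 0 + (k1 * F w 1 + (k2 * F w (- 1) + k3 * F w \<i>)))"
    for k0 k1 k2 k3
    by (intro biaffine_add biaffine_cmult assms)
  consider "p = 0 \<and> q = 0" | "p = 1 \<and> q = 1" | "\<not> (p = 0 \<and> q = 0)" "\<not> (p = 1 \<and> q = 1)" by blast
  then show ?thesis
  proof cases
    case 1
    then show ?thesis using lin[of 1 0 0 0] by (simp add: biaffine_coeff_def)
  next
    case 2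
    then show ?thesis using lin[of "-1" "1/2" "1/2" 0]
      by (simp add: biaffine_coeff_def add_divide_distrib)
  next
    case 3
    let ?s = "if p = 1 then \<i> else - \<i>"
    have "biaffine_coeff p q h = 0 * h 0 + ((1 + ?s) / 4 * h 1 + ((- 1 + ?s) / 4 * h (- 1) + (- ?s / 2) * h \<i>))"
      for h
      unfolding biaffine_coeff_def if_not_P[OF 3(1)] if_not_P[OF 3(2)] by algebra
    then show ?thesis using lin[of 0 "(1 + ?s) / 4" "(- 1 + ?s) / 4" "- ?s / 2"]
      by (simp only:)
  qed
qed

lemma sum_PiE_insert:
  assumes "\<alpha> \<notin> S"
  shows "(\<Sum>p\<in>PiE (insert \<alpha> S) (\<lambda>_. B). F p) = (\<Sum>b\<in>B. \<Sum>p\<in>PiE S (\<lambda>_. B). F (p(\<alpha> := b)))"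
proof -
  have "(\<Sum>p\<in>PiE (insert \<alpha> S) (\<lambda>_. B). F p) =
      (\<Sum>x\<in>B \<times> PiE S (\<lambda>_. B). F ((\<lambda>(b, p). p(\<alpha> := b)) x))"
    unfolding PiE_insert_eq using sum.reindex[OF inj_combinator[OF assms]] by (simp only: o_def)
  then show ?thesis
    by (simp add: sum.cartesian_product case_prod_unfold)
qed

text \<open>The polynomials of degree at most one in each of the variables \<open>z\<^sub>i\<close> and \<open>cnj z\<^sub>i\<close> with \<open>i \<in> S\<close>.\<close>

definition squarefree_poly ::
    "'n set \<Rightarrow> (('n \<Rightarrow> nat) \<Rightarrow> ('n \<Rightarrow> nat) \<Rightarrow> complex) \<Rightarrow> complex^'n::finite \<Rightarrow> complex" where
  "squarefree_poly S C z =
     (\<Sum>p\<in>S \<rightarrow>\<^sub>E {0, 1}. \<Sum>q\<in>S \<rightarrow>\<^sub>E {0, 1}. C p q * (\<Prod>i\<in>S. (z $ i) ^ p i * cnj (z $ i) ^ q i))"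

text \<open>Induction on the set of coordinates. Expanding \<open>g\<close> in a new coordinate \<open>\<alpha>\<close> gives coefficient functions
  that do not depend on \<open>z\<^sub>\<alpha>\<close> and are again biaffine in the coordinates of \<open>S\<close>. Restricting to vectors
  supported in \<open>S\<close> makes the resulting \<open>C\<close> genuinely constant, without parameters from the other
  coordinates.\<close>

lemma separately_biaffine_squarefree_poly:
  fixes g :: "complex^'n::finite \<Rightarrow> complex" and S :: "'n set"
  assumes "\<And>z i. i \<in> S \<Longrightarrow> biaffine (\<lambda>w. g (upd_coord z i w))"
  shows "\<exists>C. \<forall>z. (\<forall>i. i \<notin> S \<longrightarrow> z $ i = 0) \<longrightarrow>
    g z = squarefree_poly S C z"
  using finite[of S] assms
proof (induction S arbitrary: g rule: finite_induct)
  case empty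
  show ?case
  proof (intro exI[of _ "\<lambda>_ _. g 0"] allI impI)
    fix z :: "complex^'n"
    assume "\<forall>i. i \<notin> {} \<longrightarrow> z $ i = 0"
    then have "z = 0"
      by (simp add: vec_eq_iff)
    then show "g z = squarefree_poly {} (\<lambda>_ _. g 0) z"
      by (simp add: squarefree_poly_def)
  qed
next
  case (insert \<alpha> S)
  define G where "G a b z = biaffine_coeff a b (\<lambda>v. g (upd_coord z \<alpha> v))"
    for a b and z :: "complex^'n"
  have "biaffine (\<lambda>w. G a b (upd_coord z i w))" if "i \<in> S" for a b z i
  proof -
    have "i \<noteq> \<alpha>"
      using that insert.hyps by blast
    then have swap: "upd_coord (upd_coord z i w) \<alpha> v = upd_coord (upd_coord z \<alpha> v) i w" for w v
      by (rule upd_coord_commute)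
    show ?thesis
      unfolding G_def swap
      by (intro biaffine_biaffine_coeff insert.prems insertI2 that)
  qed
  then have "\<forall>a b. \<exists>C. \<forall>z. (\<forall>i. i \<notin> S \<longrightarrow> z $ i = 0) \<longrightarrow> G a b z = squarefree_poly S C z"
    by (intro allI insert.IH)
  then obtain C where C: "\<And>a b z. (\<forall>i. i \<notin> S \<longrightarrow> z $ i = 0) \<Longrightarrow> G a b z = squarefree_poly S (C a b) z"
    unfolding choice_iff by blast
  \<comment> \<open>Functions in \<open>S \<rightarrow>\<^sub>E {0, 1}\<close> take the value \<open>undefined\<close> at \<open>\<alpha>\<close>, so resetting that value recovers the
    exponents on \<open>S\<close>.\<close>
  define C' where "C' p q = C (p \<alpha>) (q \<alpha>) (p(\<alpha> := undefined)) (q(\<alpha> := undefined))" for p q :: "'n \<Rightarrow> nat"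
  have "g z = squarefree_poly (insert \<alpha> S) C' z"
    if z: "\<forall>i. i \<notin> insert \<alpha> S \<longrightarrow> z $ i = 0" for z
  proof -
    let ?z = "upd_coord z \<alpha> 0"
    have monom: "(\<Prod>i\<in>S. (?z $ i) ^ p i * cnj (?z $ i) ^ q i) = (\<Prod>i\<in>S. (z $ i) ^ p i * cnj (z $ i) ^ q i)"
      for p q :: "'n \<Rightarrow> nat"
      using insert.hyps by (intro prod.cong) auto
    have monom_upd: "(\<Prod>i\<in>S. (z $ i) ^ (p(\<alpha> := a)) i * cnj (z $ i) ^ (q(\<alpha> := b)) i) =
        (\<Prod>i\<in>S. (z $ i) ^ p i * cnj (z $ i) ^ q i)" for p q :: "'n \<Rightarrow> nat" and a b
      using insert.hyps by (intro prod.cong) auto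
    have exponent_reset: "p(\<alpha> := undefined) = p" if "p \<in> S \<rightarrow>\<^sub>E {0, 1}" for p :: "'n \<Rightarrow> nat"
      using PiE_arb[OF that insert.hyps(2)] by auto
    have coeff: "C a b p q * (\<Prod>i\<in>S. (z $ i) ^ p i * cnj (z $ i) ^ q i) *
          ((z $ \<alpha>) ^ a * cnj (z $ \<alpha>) ^ b) =
        C' (p(\<alpha> := a)) (q(\<alpha> := b)) *
          (\<Prod>i\<in>insert \<alpha> S. (z $ i) ^ (p(\<alpha> := a)) i * cnj (z $ i) ^ (q(\<alpha> := b)) i)"
      if "p \<in> S \<rightarrow>\<^sub>E {0, 1}" "q \<in> S \<rightarrow>\<^sub>E {0, 1}" for a b p q
      unfolding prod.insert[OF insert.hyps] monom_upd
      by (simp add: C'_def exponent_reset[OF that(1)] exponent_reset[OF that(2)])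
    have "\<forall>i. i \<notin> S \<longrightarrow> ?z $ i = 0"
      using z by auto
    note G_eq = C[OF this, unfolded squarefree_poly_def monom]
    have "g z = (\<Sum>a\<in>{0,1}. \<Sum>b\<in>{0,1}. G a b ?z * ((z $ \<alpha>) ^ a * cnj (z $ \<alpha>) ^ b))"
      using biaffine_expansion[OF insert.prems, of \<alpha> z "z $ \<alpha>"] by (simp add: G_def)
    also have "\<dots> = (\<Sum>a\<in>{0,1}. \<Sum>b\<in>{0,1}. \<Sum>p\<in>S \<rightarrow>\<^sub>E {0, 1}. \<Sum>q\<in>S \<rightarrow>\<^sub>E {0, 1}.
        C a b p q * (\<Prod>i\<in>S. (z $ i) ^ p i * cnj (z $ i) ^ q i) * ((z $ \<alpha>) ^ a * cnj (z $ \<alpha>) ^ b))"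
      unfolding G_eq sum_distrib_right ..
    also have "\<dots> = (\<Sum>a\<in>{0,1}. \<Sum>p\<in>S \<rightarrow>\<^sub>E {0, 1}. \<Sum>b\<in>{0,1}. \<Sum>q\<in>S \<rightarrow>\<^sub>E {0, 1}.
        C a b p q * (\<Prod>i\<in>S. (z $ i) ^ p i * cnj (z $ i) ^ q i) * ((z $ \<alpha>) ^ a * cnj (z $ \<alpha>) ^ b))"
      by (intro sum.cong refl sum.swap)
    also have "\<dots> = (\<Sum>p\<in>insert \<alpha> S \<rightarrow>\<^sub>E {0, 1}. \<Sum>q\<in>insert \<alpha> S \<rightarrow>\<^sub>E {0, 1}.
        C' p q * (\<Prod>i\<in>insert \<alpha> S. (z $ i) ^ p i * cnj (z $ i) ^ q i))"
      unfolding sum_PiE_insert[OF insert.hyps(2)] by (intro sum.cong refl coeff)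
    finally show ?thesis unfolding squarefree_poly_def .
  qed
  then show ?case
    by blast
qed

section \<open>The potential function\<close>

text \<open>For real \<open>f\<close>, the equation \<open>Z\<^sub>\<alpha> Z\<^sub>\<alpha> f = 0\<close> contains two real equations, which are exactly the
  hypotheses of \<open>plane_quadratic\<close> in the plane of \<open>z\<^sub>\<alpha>\<close>. In complex notation
  \<open>p x + q y = (p - \<i> q) w / 2 + (p + \<i> q) cnj w / 2\<close> and \<open>x\<^sup>2 + y\<^sup>2 = w cnj w\<close>.\<close>

lemma heis_soliton_biaffine:
  fixes f :: "'n::finite heisenberg \<Rightarrow> real"
  assumes "CR_Yamabe_soliton heis_theta heis_T (heis_Z :: 'n \<Rightarrow> _) f \<mu>"
  shows "biaffine (\<lambda>w. of_real (f (upd_coord z \<alpha> w, 0)))"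
proof -
  let ?X = "heis_X \<alpha>" and ?Y = "heis_Y \<alpha>"
  note sol = heis_soliton_equations[OF assms]
  have "(of_real (dir_deriv ?X (dir_deriv ?X f) y - dir_deriv ?Y (dir_deriv ?Y f) y) :: complex) =
      2 * \<i> * of_real (dir_deriv ?X (dir_deriv ?Y f) y)" for y
    using heis_Z_Z_real[OF sol(1,2), of \<alpha> y] sol(3)[of \<alpha> y] by simp
  then have "dir_deriv ?X (dir_deriv ?X f) y = dir_deriv ?Y (dir_deriv ?Y f) y"
    and "dir_deriv ?X (dir_deriv ?Y f) y = 0" for y
    by (simp_all add: complex_eq_iff)
  note quad = plane_quadratic[OF sol(1) this(2,1)]
  define x :: "'n heisenberg" where "x = (upd_coord z \<alpha> 0, 0)"
  define k p q m where "k = f x" and "p = dir_deriv ?X f x" and "q = dir_deriv ?Y f x"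
    and "m = dir_deriv ?X (dir_deriv ?X f) x"
  have "complex_of_real (f (upd_coord z \<alpha> w, 0)) = of_real k + (of_real p - \<i> * of_real q) / 2 * w +
      (of_real p + \<i> * of_real q) / 2 * cnj w + of_real (m / 2) * (w * cnj w)" for w
  proof -
    have "(upd_coord z \<alpha> w, 0) = x + Re w *\<^sub>R ?X + Im w *\<^sub>R ?Y"
      by (auto simp: x_def vec_eq_iff axis_def complex_eq_iff)
    then have "f (upd_coord z \<alpha> w, 0) = k + Re w * p + Im w * q + ((Re w)\<^sup>2 + (Im w)\<^sup>2) / 2 * m"
      using quad[of x "Re w" "Im w"] by (simp add: k_def p_def q_def m_def)
    then show ?thesis
      by (simp add: complex_eq_iff power2_eq_square field_simps)
  qed
  then show ?thesis
    unfolding biaffine_def by blast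
qed

theorem theorem5p2:
  fixes f :: "'n::finite heisenberg \<Rightarrow> real" and \<mu> :: real
  assumes "CR_Yamabe_soliton heis_theta heis_T (heis_Z :: 'n \<Rightarrow> _) f \<mu>"
  shows "\<exists>C :: ('n \<Rightarrow> nat) \<Rightarrow> ('n \<Rightarrow> nat) \<Rightarrow> complex. \<forall>z t.
    complex_of_real (f (z, t)) = of_real (2 * \<mu> * t) +
      (\<Sum>p\<in>UNIV \<rightarrow>\<^sub>E {0, 1}. \<Sum>q\<in>UNIV \<rightarrow>\<^sub>E {0, 1}.
         C p q * (\<Prod>i\<in>UNIV. (z $ i) ^ p i * cnj (z $ i) ^ q i))"
proof -
  obtain C where C: "\<And>z. complex_of_real (f (z, 0)) = squarefree_poly UNIV C z"
    using separately_biaffine_squarefree_poly[of UNIV "\<lambda>z. of_real (f (z, 0))"]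
      heis_soliton_biaffine[OF assms] by auto
  have eq: "f (z, t) = f (z, 0) + t * (2 * \<mu>)" for z t
    using constant_dir_deriv_line[OF heis_soliton_equations(1,2)[OF assms], of "(z, 0)" t] by simp
  have "complex_of_real (f (z, t)) = of_real (2 * \<mu> * t) + squarefree_poly UNIV C z" for z t
    unfolding eq[of z t] of_real_add C by (simp add: mult.commute)
  then show ?thesis
    unfolding squarefree_poly_def by blast
qed

end
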